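(* Let $\mathcal H$ be a real Hilbert space, let $\phi:\mathcal H\to\mathbb R$ be a convex differentiable function whose gradient $\nabla\phi$ is Lipschitz continuous on the bounded subsets of $\mathcal H$, and let $A:\mathcal H\to\mathcal H$ be maximal monotone and $\lambda$-cocoercive for some $\lambda>0$. Let $\gamma>0$ with $\lambda\gamma^2>1$, and suppose that $S:=(\nabla\phi+A)^{-1}(0)=\{v\in\mathcal H:\nabla\phi(v)+Av=0\}\neq\emptyset$. Assume moreover that $\nabla\phi+A$ is strongly monotone over bounded sets. Then, for all $u_0,v_0\in\mathcal H$, the solution $u\in C^2([0,+\infty);\mathcal H)$ of $$\ddot u(t)+\gamma\dot u(t)+\nabla\phi(u(t))+A(u(t))=0,\qquad u(0)=u_0,\ \dot u(0)=v_0,$$ converges strongly in $\mathcal H$, as $t\to+\infty$, to the unique element of $S$.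
   Context: $\langle\cdot,\cdot\rangle$ and $|\cdot|$ denote the scalar product and norm of $\mathcal H$. An operator $A:\mathcal H\to\mathcal H$ is $\lambda$-cocoercive, $\lambda>0$, if $\langle Av-Aw,v-w\rangle\ge\lambda|Av-Aw|^2$ for all $v,w\in\mathcal H$. The operator $\nabla\phi+A$ is called strongly monotone over bounded sets if, for every real $R>0$, there exists a continuous function $w_R:\mathbb R_+\to\mathbb R_+$ such that (for sequences $(t_n)$ in $\mathbb R_+$) $w_R(t_n)\to0\Rightarrow t_n\to0$, and such that for all $u,v\in\mathcal H$ with $|u|\le R$, $|v|\le R$, $$\langle(\nabla\phi+A)u-(\nabla\phi+A)v,\,u-v\rangle\ge w_R(|u-v|).$$ *)

theory Defs
  imports "HOL-Analysis.Analysis"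
begin

text \<open>Set-valued operators are represented by their graphs; the single-valued operator
  \<open>A\<close> has the graph \<open>range (\<lambda>x. (x, A x))\<close>. Maximality is with respect to inclusion among
  all monotone graphs, not only among graphs of functions.\<close>

definition monotone_graph :: "('a::real_inner \<times> 'a) set \<Rightarrow> bool" where
  "monotone_graph M \<longleftrightarrow>
     (\<forall>x y x' y'. (x, y) \<in> M \<longrightarrow> (x', y') \<in> M \<longrightarrow> inner (y - y') (x - x') \<ge> 0)"

definition maximal_monotone_graph :: "('a::real_inner \<times> 'a) set \<Rightarrow> bool" where
  "maximal_monotone_graph M \<longleftrightarrow>
     monotone_graph M \<and> (\<forall>N. monotone_graph N \<longrightarrow> M \<subseteq> N \<longrightarrow> N = M)"

definition maximal_monotone :: "('a::real_inner \<Rightarrow> 'a) \<Rightarrow> bool" where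
  "maximal_monotone A \<longleftrightarrow> maximal_monotone_graph (range (\<lambda>x. (x, A x)))"

definition cocoercive :: "real \<Rightarrow> ('a::real_inner \<Rightarrow> 'a) \<Rightarrow> bool" where
  "cocoercive l A \<longleftrightarrow> l > 0 \<and> (\<forall>v w. inner (A v - A w) (v - w) \<ge> l * (norm (A v - A w))\<^sup>2)"

definition strongly_monotone_on_bounded :: "('a::real_inner \<Rightarrow> 'a) \<Rightarrow> bool" where
  "strongly_monotone_on_bounded T \<longleftrightarrow>
     (\<forall>R>0. \<exists>w :: real \<Rightarrow> real.
        continuous_on {0..} w \<and> (\<forall>t\<ge>0. w t \<ge> 0) \<and>
        (\<forall>t :: nat \<Rightarrow> real. (\<forall>n. t n \<ge> 0) \<longrightarrow> (\<lambda>n. w (t n)) \<longlonglongrightarrow> 0 \<longrightarrow> t \<longlonglongrightarrow> 0) \<and>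
        (\<forall>u v. norm u \<le> R \<longrightarrow> norm v \<le> R \<longrightarrow> inner (T u - T v) (u - v) \<ge> w (norm (u - v))))"

text \<open>\<open>u\<close> is a twice continuously differentiable solution on \<open>[0, \<infinity>)\<close> of
  \<open>u'' + \<gamma> u' + g(u) + A(u) = 0\<close>, \<open>u(0) = u0\<close>, \<open>u'(0) = v0\<close>. The derivatives are one-sided
  at \<open>0\<close>, and the values of \<open>u\<close> at negative times are irrelevant.\<close>

definition C2_solution ::
  "real \<Rightarrow> ('a::real_inner \<Rightarrow> 'a) \<Rightarrow> ('a \<Rightarrow> 'a) \<Rightarrow> 'a \<Rightarrow> 'a \<Rightarrow> (real \<Rightarrow> 'a) \<Rightarrow> bool" where
  "C2_solution \<gamma> g A u0 v0 u \<longleftrightarrow>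
     (\<exists>u' u''.
        (\<forall>t\<ge>0. (u has_vector_derivative u' t) (at t within {0..})) \<and>
        (\<forall>t\<ge>0. (u' has_vector_derivative u'' t) (at t within {0..})) \<and>
        continuous_on {0..} u'' \<and>
        (\<forall>t\<ge>0. u'' t + \<gamma> *\<^sub>R u' t + g (u t) + A (u t) = 0) \<and>
        u 0 = u0 \<and> u' 0 = v0)"

end

theory Submission
  imports Defs
begin

text \<open>Convergence rests on the energy
  \<open>1/2 |u' + \<gamma>/2 (u - p)|\<^sup>2 + D(u) + \<gamma>\<^sup>2/8 |u - p|\<^sup>2\<close>, where \<open>p \<in> S\<close> and \<open>D\<close> is the
  Bregman distance of \<open>\<phi>\<close> from \<open>p\<close>. Cocoercivity and \<open>l * \<gamma>\<^sup>2 > 1\<close> make its derivative at most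
  \<open>- c \<langle>(\<nabla>\<phi> + A) u, u - p\<rangle>\<close> with \<open>c > 0\<close>. Being coercive and nonincreasing, the energy bounds
  \<open>(u, u')\<close> a priori, which turns a Picard argument for a truncated field into global existence.
  Being nonnegative, it cannot drop by a fixed amount infinitely often; since \<open>u\<close> is Lipschitz,
  strong monotonicity would force this if \<open>u\<close> were repeatedly far from \<open>p\<close>.\<close>

subsection \<open>Global solutions of autonomous initial value problems\<close>

lemma at_within_atLeast_eq_atLeastAtMost:
  fixes a t b :: real
  assumes "t < b"
  shows "at t within {a..} = at t within {a..b}"
  by (rule at_within_nhd[of t "{..<b}"]) (use assms in auto)

lemma has_vector_derivative_integral_atLeast:
  fixes f :: "real \<Rightarrow> 'b::banach"
  assumes "continuous_on {0..} f" "0 \<le> t"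
  shows "((\<lambda>s. integral {0..s} f) has_vector_derivative f t) (at t within {0..})"
proof -
  have "((\<lambda>s. integral {0..s} f) has_vector_derivative f t) (at t within {0..t+1})"
    using assms by (intro integral_has_vector_derivative) (auto intro: continuous_on_subset)
  then show ?thesis
    by (simp add: at_within_atLeast_eq_atLeastAtMost[of t "t+1"])
qed

text \<open>Integrating the weight \<open>exp (k * s)\<close> gains the factor \<open>1 / k\<close>;
  this gain is what turns the weighted Picard operator into a contraction.\<close>

lemma norm_integral_le_exp:
  fixes f :: "real \<Rightarrow> 'b::banach"
  assumes f: "continuous_on {0..} f" and k: "k > 0" and t: "0 \<le> t"
    and bound: "\<And>s. 0 \<le> s \<Longrightarrow> norm (f s) \<le> C * exp (k * s)"
  shows "norm (integral {0..t} f) \<le> C / k * exp (k * t)"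
proof -
  have C: "0 \<le> C"
    using order_trans[OF norm_ge_zero bound[of 0]] by simp
  have int: "((\<lambda>s. C * exp (k * s)) has_integral (C / k * exp (k * t) - C / k * exp (k * 0))) {0..t}"
    using k by (intro fundamental_theorem_of_calculus t)
      (auto intro!: derivative_eq_intros simp flip: has_real_derivative_iff_has_vector_derivative)
  have "norm (integral {0..t} f) \<le> integral {0..t} (\<lambda>s. C * exp (k * s))"
    using bound has_integral_integrable[OF int]
    by (intro integral_norm_bound_integral integrable_continuous_real[OF continuous_on_subset[OF f]])
      auto
  also have "\<dots> = C / k * exp (k * t) - C / k"
    using integral_unique[OF int] by simp
  also have "\<dots> \<le> C / k * exp (k * t)"
    using C k by simp
  finally show ?thesis .
qed

text \<open>Writing \<open>x t = exp (k * t) *\<^sub>R y t\<close> makes the Picard operator a contraction on all of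
  \<open>[0, \<infinity>)\<close> at once; the argument \<open>max 0 t\<close> only extends functions to the whole line.\<close>

lemma lipschitz_ivp_exists:
  fixes F :: "'b::banach \<Rightarrow> 'b"
  assumes lip: "L-lipschitz_on UNIV F"
  shows "\<exists>x. x 0 = x0 \<and> (\<forall>t\<ge>0. (x has_vector_derivative F (x t)) (at t within {0..}))"
proof -
  have L: "0 \<le> L"
    using lip by (rule lipschitz_on_nonneg)
  \<comment> \<open>Any rate above \<open>L\<close> would do: the contraction factor will be
    \<open>L / k\<close>.\<close>
  define k where "k = L + 1"
  have k: "k > 0"
    using L by (simp add: k_def)
  have exp_cancel: "exp (- a) * (b * exp a) = b" for a b :: real
    by (simp add: exp_minus)
  define f where "f y s = F (exp (k * s) *\<^sub>R apply_bcontfun y s)" for y :: "real \<Rightarrow>\<^sub>C 'b" and s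
  define g where "g y t = exp (- (k * max 0 t)) *\<^sub>R (x0 + integral {0..max 0 t} (f y))"
    for y :: "real \<Rightarrow>\<^sub>C 'b" and t
  have F_cont: "continuous_on UNIV F"
    using lip by (rule lipschitz_on_continuous_on)
  have f_cont: "continuous_on S (f y)" for S y
    unfolding f_def
    by (intro continuous_on_compose2[OF F_cont] continuous_intros continuous_on_apply_bcontfun) auto
  have int_deriv: "((\<lambda>s. integral {0..s} (f y)) has_vector_derivative f y t) (at t within {0..})"
    if "0 \<le> t" for y t
    using f_cont that by (rule has_vector_derivative_integral_atLeast)
  then have "continuous_on {0..} (\<lambda>s. integral {0..s} (f y))" for y
    by (auto simp: continuous_on_eq_continuous_within intro: has_vector_derivative_continuous)
  then have g_cont: "continuous_on UNIV (g y)" for y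
    unfolding g_def
    by (intro continuous_intros continuous_on_compose2[of "{0..}" _ _ "\<lambda>t. max 0 t"]) auto
  have f_diff: "norm (f y s - f z s) \<le> L * dist y z * exp (k * s)" for y z s
  proof -
    have "norm (f y s - f z s) \<le> L * (exp (k * s) * dist (apply_bcontfun y s) (apply_bcontfun z s))"
      using lipschitz_onD[OF lip, of "exp (k * s) *\<^sub>R y s" "exp (k * s) *\<^sub>R z s"]
      by (simp add: f_def dist_norm flip: scaleR_diff_right)
    also have "\<dots> \<le> L * (exp (k * s) * dist y z)"
      by (intro mult_left_mono dist_bounded L) auto
    finally show ?thesis
      by (simp add: algebra_simps)
  qed
  have g_diff: "norm (g y t - g z t) \<le> L / k * dist y z" for y z t
  proof -
    let ?t = "max 0 t"
    have "norm (integral {0..?t} (\<lambda>s. f y s - f z s)) \<le> L * dist y z / k * exp (k * ?t)"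
      using f_diff f_cont k by (intro norm_integral_le_exp continuous_on_diff) auto
    moreover have "integral {0..?t} (\<lambda>s. f y s - f z s)
        = integral {0..?t} (f y) - integral {0..?t} (f z)"
      by (intro integral_diff integrable_continuous_real f_cont)
    ultimately have "norm (g y t - g z t) \<le> exp (- (k * ?t)) * (L * dist y z / k * exp (k * ?t))"
      unfolding g_def by (simp add: mult_left_mono flip: scaleR_diff_right times_divide_eq_right)
    then show ?thesis
      unfolding exp_cancel by simp
  qed
  \<comment> \<open>Boundedness is computed directly only for \<open>y = 0\<close>, where
    \<open>f 0\<close> is constantly \<open>F 0\<close>; for every other \<open>y\<close> it then
    follows from \<open>g_diff\<close>.\<close>
  have "g 0 \<in> bcontfun"
  proof (rule bcontfun_normI[OF g_cont])
    fix t :: real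
    let ?t = "max 0 t"
    have "norm (f 0 s) \<le> norm (F 0) * exp (k * s)" if "0 \<le> s" for s
      using that k mult_left_mono[of 1 "exp (k * s)" "norm (F 0)"] by (simp add: f_def)
    then have "norm (integral {0..?t} (f 0)) \<le> norm (F 0) / k * exp (k * ?t)"
      using f_cont k by (intro norm_integral_le_exp) auto
    moreover have "norm x0 \<le> norm x0 * exp (k * ?t)"
      using k mult_left_mono[of 1 "exp (k * ?t)" "norm x0"] by simp
    ultimately have "norm (x0 + integral {0..?t} (f 0)) \<le> (norm x0 + norm (F 0) / k) * exp (k * ?t)"
      by (simp add: algebra_simps norm_triangle_le)
    then have "norm (g 0 t) \<le> exp (- (k * ?t)) * ((norm x0 + norm (F 0) / k) * exp (k * ?t))"
      unfolding g_def by simp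
    then show "norm (g 0 t) \<le> norm x0 + norm (F 0) / k"
      unfolding exp_cancel .
  qed
  then obtain C where C: "\<And>t. norm (g 0 t) \<le> C"
    by (auto simp: bcontfun_def bounded_iff)
  have "norm (g y t) \<le> C + L / k * dist y 0" for y t
    using g_diff[of y t 0] C[of t] norm_triangle_ineq2[of "g y t" "g 0 t"] by simp
  then have "g y \<in> bcontfun" for y
    using g_cont by (intro bcontfun_normI)
  then have apply_G: "apply_bcontfun (Bcontfun (g y)) = g y" for y
    by (rule Bcontfun_inverse)
  \<comment> \<open>The Picard operator is now a self-map of the complete space of bounded
    continuous functions, so Banach's fixed point theorem applies.\<close>
  have "dist (Bcontfun (g y)) (Bcontfun (g z)) \<le> L / k * dist y z" for y z
    using g_diff by (intro dist_bound) (simp add: apply_G dist_norm)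
  then have "\<exists>!y\<in>UNIV. Bcontfun (g y) = y"
    using L k by (intro Banach_fix[where c = "L / k"]) (auto simp: k_def complete_UNIV)
  then obtain y where y: "Bcontfun (g y) = y"
    by auto
  define x where "x t = exp (k * t) *\<^sub>R apply_bcontfun y t" for t
  have x_eq: "x t = x0 + integral {0..t} (f y)" if "0 \<le> t" for t
  proof -
    have "apply_bcontfun y t = g y t"
      using apply_G[of y] y by simp
    then show ?thesis
      using that by (simp add: x_def g_def exp_minus)
  qed
  have "(x has_vector_derivative F (x t)) (at t within {0..})" if "0 \<le> t" for t
  proof -
    have "((\<lambda>t. x0 + integral {0..t} (f y)) has_vector_derivative f y t) (at t within {0..})"
      using int_deriv[OF that, of y] by (auto intro!: derivative_eq_intros)
    then show ?thesis
      using that x_eq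
      by (subst has_vector_derivative_cong_ev[where g = "\<lambda>t. x0 + integral {0..t} (f y)"])
        (auto simp: f_def x_def eventually_at_filter)
  qed
  moreover have "x 0 = x0"
    using x_eq[of 0] by simp
  ultimately show ?thesis
    by blast
qed

text \<open>This is the radial retraction onto the ball. The constant 2 is what the triangle
  inequality yields in an arbitrary normed space.\<close>

lemma truncation_to_cball:
  fixes R :: real
  assumes R: "R > 0"
  obtains r :: "'b::real_normed_vector \<Rightarrow> 'b"
  where "2-lipschitz_on UNIV r" "\<And>x. norm (r x) \<le> R" "\<And>x. norm x \<le> R \<Longrightarrow> r x = x"
proof -
  define m where "m x = max R (norm x)" for x :: 'b
  define r where "r x = (R / m x) *\<^sub>R x" for x :: 'b
  have m: "R \<le> m x" "norm x \<le> m x" "0 < m x" for x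
    using R by (auto simp: m_def)
  have "norm (r x - r y) \<le> 2 * norm (x - y)" for x y
  proof -
    have "\<bar>m y - m x\<bar> \<le> norm (x - y)"
      using norm_triangle_ineq3[of x y] by (auto simp: m_def max_def)
    moreover have "R / m x \<le> 1" "norm y / m y \<le> 1"
      using m by simp_all
    \<comment> \<open>The difference \<open>r x - r y\<close> is split into a change of the vector
      and a change of the scaling factor. Each contributes at most \<open>norm (x - y)\<close>; this
      estimate serves the second.\<close>
    ultimately have "R / m x * (norm y / m y) * \<bar>m y - m x\<bar> \<le> 1 * 1 * norm (x - y)"
      using R m(3)[of x] m(3)[of y] by (intro mult_mono) auto
    moreover have "R / m x - R / m y = R / m x * (m y - m x) / m y"
      using m(3)[of x] m(3)[of y] by (simp add: field_simps)
    then have "norm ((R / m x - R / m y) *\<^sub>R y) = R / m x * (norm y / m y) * \<bar>m y - m x\<bar>"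
      using R m(3)[of x] m(3)[of y] by (simp add: abs_mult)
    ultimately have "norm ((R / m x - R / m y) *\<^sub>R y) \<le> norm (x - y)"
      by simp
    moreover have "norm ((R / m x) *\<^sub>R (x - y)) \<le> norm (x - y)"
      using R m[of x] mult_left_le_one_le[of "norm (x - y)" "R / m x"] by simp
    moreover have "r x - r y = (R / m x) *\<^sub>R (x - y) + (R / m x - R / m y) *\<^sub>R y"
      by (simp add: r_def algebra_simps)
    ultimately show ?thesis
      using norm_triangle_le[of "(R / m x) *\<^sub>R (x - y)" "(R / m x - R / m y) *\<^sub>R y"
          "2 * norm (x - y)"] by simp
  qed
  then have "2-lipschitz_on UNIV r"
    by (intro lipschitz_onI) (auto simp: dist_norm)
  moreover have "norm (r x) \<le> R" for x
    using R m[of x] by (simp add: r_def field_simps)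
  moreover have "r x = x" if "norm x \<le> R" for x
    using R that by (simp add: r_def m_def max_absorb1)
  ultimately show ?thesis
    by (rule that)
qed

text \<open>The field is replaced by a globally Lipschitz one that agrees with it on a ball larger than
  the a priori bound; the solution of the truncated problem never leaves that ball.\<close>

lemma ivp_exists_of_apriori_bound:
  fixes F :: "'b::banach \<Rightarrow> 'b"
  assumes lip: "\<And>R. \<exists>L. L-lipschitz_on (cball 0 R) F"
    and apriori: "\<And>T x. 0 \<le> T \<Longrightarrow> x 0 = x0 \<Longrightarrow>
      (\<And>t. t \<in> {0..T} \<Longrightarrow> (x has_vector_derivative F (x t)) (at t within {0..T})) \<Longrightarrow>
      norm (x T) \<le> C"
  shows "\<exists>x. x 0 = x0 \<and> (\<forall>t\<ge>0. (x has_vector_derivative F (x t)) (at t within {0..}))"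
proof -
  \<comment> \<open>The a priori bound at \<open>T = 0\<close> covers the initial value, since
    differentiability within a single point is trivial.\<close>
  have C: "norm x0 \<le> C"
    using apriori[of 0 "\<lambda>_. x0"] by (simp add: has_vector_derivative_def has_derivative_within_singleton_iff
          bounded_linear_scaleR_left)
  \<comment> \<open>The margin 1 is what gives the contradiction below: a solution reaching radius
    \<open>R\<close> would violate the bound \<open>C\<close>.\<close>
  define R where "R = C + 1"
  have R: "R > 0"
    using C norm_ge_zero[of x0] unfolding R_def by linarith
  obtain r :: "'b \<Rightarrow> 'b" where r_lip: "2-lipschitz_on UNIV r"
    and r_le: "\<And>x. norm (r x) \<le> R" and r_id: "\<And>x. norm x \<le> R \<Longrightarrow> r x = x"
    using truncation_to_cball[OF R] by blast
  obtain L where L: "L-lipschitz_on (cball 0 R) F"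
    using lip by blast
  have "L-lipschitz_on (range r) F"
    using r_le by (intro lipschitz_on_subset[OF L]) auto
  then have "(L * 2)-lipschitz_on UNIV (F \<circ> r)"
    using r_lip by (intro lipschitz_on_compose)
  then obtain x where x0: "x 0 = x0"
    and x: "\<And>t. 0 \<le> t \<Longrightarrow> (x has_vector_derivative F (r (x t))) (at t within {0..})"
    using lipschitz_ivp_exists[of "L * 2" "F \<circ> r" x0] by auto
  have cont: "continuous_on {0..} (\<lambda>t. norm (x t))"
    using x unfolding continuous_on_eq_continuous_within
    by (blast intro: continuous_norm has_vector_derivative_continuous)
  have below: "norm (x t) < R" if "0 \<le> t" for t
  proof (rule ccontr)
    \<comment> \<open>The infimum of the closed set \<open>B\<close> is the first time at which the
      ball of radius \<open>R\<close> is no longer strictly contained around the solution.\<close>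
    define B where "B = {s \<in> {0..}. R \<le> norm (x s)}"
    assume "\<not> norm (x t) < R"
    then have "t \<in> B"
      using that by (simp add: B_def)
    have "closed B"
      unfolding B_def by (intro continuous_on_closed_Collect_le cont continuous_on_const) auto
    moreover have bdd: "bdd_below B"
      by (auto simp: B_def intro: bdd_belowI)
    ultimately have "Inf B \<in> B"
      using \<open>t \<in> B\<close> by (intro closed_contains_Inf) auto
    define T where "T = Inf B"
    have T: "0 \<le> T" "R \<le> norm (x T)"
      using \<open>Inf B \<in> B\<close> by (auto simp: B_def T_def)
    have first: "norm (x s) < R" if "0 \<le> s" "s < T" for s
      using cInf_lower[OF _ bdd, of s] that by (force simp: B_def T_def)
    \<comment> \<open>The intermediate value theorem gives a time with norm exactly
      \<open>R\<close>, which can only be \<open>T\<close>. Up to \<open>T\<close> the truncation is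
      therefore inactive and the a priori bound applies.\<close>
    obtain s where s: "0 \<le> s" "s \<le> T" "norm (x s) = R"
      using IVT'[of "\<lambda>t. norm (x t)" 0 R T] T x0 C R_def continuous_on_subset[OF cont, of "{0..T}"]
      by auto
    then have "norm (x T) = R"
      using first[of s] by (cases "s = T") auto
    then have "norm (x s) \<le> R" if "s \<in> {0..T}" for s
      using first[of s] that by (cases "s = T") auto
    then have "(x has_vector_derivative F (x s)) (at s within {0..T})" if "s \<in> {0..T}" for s
      using has_vector_derivative_within_subset[OF x[of s], of "{0..T}"] r_id[of "x s"] that by auto
    then have "norm (x T) \<le> C"
      using T x0 by (intro apriori)
    then show False
      using T by (simp add: R_def)
  qed
  then have "(x has_vector_derivative F (x t)) (at t within {0..})" if "0 \<le> t" for t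
    using x[OF that] r_id[of "x t"] that by (simp add: less_imp_le)
  then show ?thesis
    using x0 by blast
qed

section \<open>Uniqueness for fields that are Lipschitz on balls\<close>

lemma real_derivative_le_imp_diff_le:
  fixes f :: "real \<Rightarrow> real"
  assumes "a \<le> b"
    and deriv: "\<And>t. t \<in> {a..b} \<Longrightarrow> (f has_real_derivative f' t) (at t within {a..b})"
    and le: "\<And>t. t \<in> {a..b} \<Longrightarrow> f' t \<le> c"
  shows "f b - f a \<le> c * (b - a)"
proof -
  have "\<exists>t\<in>{a..b}. f b - f a = f' t * (b - a)"
    using \<open>a \<le> b\<close> deriv by (intro mvt_very_simple) (auto simp: has_field_derivative_def)
  then show ?thesis
    using le \<open>a \<le> b\<close> by (auto intro!: mult_right_mono)
qed

text \<open>Gronwall's argument: on a ball containing both compact trajectories, the squared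
  distance grows at rate at most \<open>2 * L\<close>, so it is nonincreasing after multiplication
  by \<open>exp (- (2 * L * t))\<close>. It starts at 0 and thus stays there.\<close>

lemma ivp_unique:
  fixes F :: "'b::real_inner \<Rightarrow> 'b"
  assumes lip: "\<And>R. \<exists>L. L-lipschitz_on (cball 0 R) F"
    and x: "\<And>t. 0 \<le> t \<Longrightarrow> (x has_vector_derivative F (x t)) (at t within {0..})"
    and y: "\<And>t. 0 \<le> t \<Longrightarrow> (y has_vector_derivative F (y t)) (at t within {0..})"
    and init: "x 0 = y 0" and T: "0 \<le> T"
  shows "x T = y T"
proof -
  have x': "(x has_vector_derivative F (x t)) (at t within {0..T})"
    and y': "(y has_vector_derivative F (y t)) (at t within {0..T})" if "t \<in> {0..T}" for t
    using that by (auto intro: has_vector_derivative_within_subset[OF x]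
        has_vector_derivative_within_subset[OF y])
  have "continuous_on {0..T} x" "continuous_on {0..T} y"
    using x' y' has_vector_derivative_continuous
    unfolding continuous_on_eq_continuous_within by blast+
  then have "bounded (x ` {0..T} \<union> y ` {0..T})"
    by (simp add: compact_continuous_image compact_imp_bounded)
  then obtain R where R: "\<And>t. t \<in> {0..T} \<Longrightarrow> x t \<in> cball 0 R \<and> y t \<in> cball 0 R"
    by (force simp: bounded_iff)
  obtain L where L: "L-lipschitz_on (cball 0 R) F"
    using lip by blast
  define D where "D t = exp (- (2 * L * t)) * inner (x t - y t) (x t - y t)" for t
  define D' where "D' t = exp (- (2 * L * t)) *
    (2 * inner (x t - y t) (F (x t) - F (y t)) - 2 * L * inner (x t - y t) (x t - y t))" for t
  have "(D has_real_derivative D' t) (at t within {0..T})" if "t \<in> {0..T}" for t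
    unfolding D_def D'_def has_field_derivative_def
    by (rule derivative_eq_intros refl x'[OF that, unfolded has_vector_derivative_def]
        y'[OF that, unfolded has_vector_derivative_def])+
      (auto simp: fun_eq_iff algebra_simps inner_commute)
  moreover have "D' t \<le> 0" if "t \<in> {0..T}" for t
  proof -
    have "inner (x t - y t) (F (x t) - F (y t)) \<le> norm (x t - y t) * norm (F (x t) - F (y t))"
      by (rule norm_cauchy_schwarz)
    also have "\<dots> \<le> norm (x t - y t) * (L * norm (x t - y t))"
      using lipschitz_onD[OF L] R[OF that] by (intro mult_left_mono) (auto simp: dist_norm)
    also have "\<dots> = L * inner (x t - y t) (x t - y t)"
      by (simp add: power2_norm_eq_inner[symmetric] power2_eq_square)
    finally show ?thesis
      by (simp add: D'_def mult_nonneg_nonpos)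
  qed
  ultimately have "D T - D 0 \<le> 0 * (T - 0)"
    using T by (intro real_derivative_le_imp_diff_le)
  then have "inner (x T - y T) (x T - y T) \<le> 0"
    using init by (simp add: D_def mult_le_0_iff)
  then have "inner (x T - y T) (x T - y T) = 0"
    by (intro antisym inner_ge_zero)
  then show ?thesis
    by simp
qed

subsection \<open>Convexity, cocoercivity and strong monotonicity\<close>

text \<open>Restriction to the line through \<open>x\<close> and \<open>y\<close> reduces this to
  the tangent inequality for a convex function of one real variable, between parameters 0 and
  1.\<close>

lemma convex_on_gradient_inequality:
  fixes \<phi> :: "'a::real_inner \<Rightarrow> real"
  assumes convex: "convex_on UNIV \<phi>" and grad: "GDERIV \<phi> x :> d"
  shows "\<phi> x + inner d (y - x) \<le> \<phi> y"
proof -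
  define f where "f s = \<phi> (x + s *\<^sub>R (y - x))" for s :: real
  have "convex_on UNIV f"
  proof (rule convex_onI)
    fix t a b :: real
    assume "0 < t" "t < 1"
    moreover have "x + ((1 - t) *\<^sub>R a + t *\<^sub>R b) *\<^sub>R (y - x)
        = (1 - t) *\<^sub>R (x + a *\<^sub>R (y - x)) + t *\<^sub>R (x + b *\<^sub>R (y - x))"
      by (simp add: algebra_simps)
    ultimately show "f ((1 - t) *\<^sub>R a + t *\<^sub>R b) \<le> (1 - t) * f a + t * f b"
      using convex_onD[OF convex, of t "x + a *\<^sub>R (y - x)" "x + b *\<^sub>R (y - x)"]
      by (simp add: f_def)
  qed simp
  moreover have "(f has_real_derivative inner d (y - x)) (at 0)"
  proof -
    have "(\<phi> has_derivative (\<lambda>h. inner h d)) (at (x + 0 *\<^sub>R (y - x)))"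
      using grad by (simp add: gderiv_def)
    moreover have "((\<lambda>s. x + s *\<^sub>R (y - x)) has_derivative (\<lambda>s. s *\<^sub>R (y - x))) (at 0)"
      by (auto intro!: derivative_eq_intros)
    ultimately have "(f has_derivative (\<lambda>s. inner (s *\<^sub>R (y - x)) d)) (at 0)"
      unfolding f_def by (rule has_derivative_compose[rotated])
    moreover have "(\<lambda>s. inner (s *\<^sub>R (y - x)) d) = (*) (inner d (y - x))"
      by (auto simp: inner_commute)
    ultimately show ?thesis
      by (simp add: has_field_derivative_def)
  qed
  ultimately have "f 1 - f 0 \<ge> inner d (y - x) * (1 - 0)"
    by (intro convex_on_imp_above_tangent) auto
  then show ?thesis
    by (simp add: f_def)
qed

text \<open>Cauchy-Schwarz bounds the inner product from above, and one factor
  \<open>norm (A v - A w)\<close> cancels when it is nonzero.\<close>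

lemma cocoercive_imp_lipschitz_on:
  assumes "cocoercive l A"
  shows "(1 / l)-lipschitz_on UNIV A"
proof (rule lipschitz_onI)
  have l: "l > 0" and coco: "l * (norm (A v - A w))\<^sup>2 \<le> inner (A v - A w) (v - w)" for v w
    using assms by (auto simp: cocoercive_def)
  show "dist (A v) (A w) \<le> 1 / l * dist v w" for v w
  proof (cases "A v = A w")
    case False
    have "l * (norm (A v - A w))\<^sup>2 \<le> norm (A v - A w) * norm (v - w)"
      using coco norm_cauchy_schwarz by (rule order_trans)
    then show ?thesis
      using False l by (simp add: dist_norm power2_eq_square field_simps)
  qed (use l in simp)
  show "0 \<le> 1 / l"
    using l by simp
qed

text \<open>The sequential condition on the modulus \<open>w\<close> becomes a uniform bound: were
  \<open>w\<close> not bounded away from 0 on \<open>{\<eta>..}\<close>, some sequence staying above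
  \<eta> would have \<open>w (t n)\<close> tending to 0 and would itself have to tend to 0.\<close>

lemma strongly_monotone_on_bounded_lower_bound:
  fixes T :: "'a::real_inner \<Rightarrow> 'a"
  assumes "strongly_monotone_on_bounded T" "0 < R" "0 < \<eta>"
  obtains m where "0 < m"
    "\<And>u v. norm u \<le> R \<Longrightarrow> norm v \<le> R \<Longrightarrow> \<eta> \<le> norm (u - v) \<Longrightarrow> m \<le> inner (T u - T v) (u - v)"
proof -
  obtain w :: "real \<Rightarrow> real" where w: "continuous_on {0..} w \<and> (\<forall>t\<ge>0. w t \<ge> 0) \<and>
        (\<forall>t :: nat \<Rightarrow> real. (\<forall>n. t n \<ge> 0) \<longrightarrow> (\<lambda>n. w (t n)) \<longlonglongrightarrow> 0 \<longrightarrow> t \<longlonglongrightarrow> 0) \<and>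
        (\<forall>u v. norm u \<le> R \<longrightarrow> norm v \<le> R \<longrightarrow> inner (T u - T v) (u - v) \<ge> w (norm (u - v)))"
    using assms(1)[unfolded strongly_monotone_on_bounded_def, rule_format, OF assms(2)] ..
  have nonneg: "w t \<ge> 0" if "t \<ge> 0" for t
    using w that by blast
  have seq: "t \<longlonglongrightarrow> 0" if "\<And>n. t n \<ge> 0" "(\<lambda>n. w (t n)) \<longlonglongrightarrow> 0" for t :: "nat \<Rightarrow> real"
    using w that by blast
  have "\<exists>m>0. \<forall>t\<ge>\<eta>. m \<le> w t"
  proof (rule ccontr)
    assume "\<not> ?thesis"
    then have "\<exists>t\<ge>\<eta>. w t < 1 / real (Suc n)" for n
      by (metis not_le of_nat_0_less_iff zero_less_Suc zero_less_divide_1_iff)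
    then obtain t where t: "\<And>n. \<eta> \<le> t n" "\<And>n. w (t n) < 1 / real (Suc n)"
      by metis
    have t_nonneg: "0 \<le> t n" for n
      using t(1)[of n] \<open>0 < \<eta>\<close> by linarith
    have lim: "(\<lambda>n. 1 / real (Suc n)) \<longlonglongrightarrow> 0"
      by (rule LIMSEQ_Suc[OF lim_inverse_n'])
    have "\<forall>\<^sub>F n in sequentially. 0 \<le> w (t n)"
      using nonneg[OF t_nonneg] by (rule always_eventually[OF allI])
    moreover have "\<forall>\<^sub>F n in sequentially. w (t n) \<le> 1 / real (Suc n)"
      using less_imp_le[OF t(2)] by (rule always_eventually[OF allI])
    ultimately have "(\<lambda>n. w (t n)) \<longlonglongrightarrow> 0"
      using tendsto_const lim by (rule tendsto_sandwich)
    then have "t \<longlonglongrightarrow> 0"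
      using t_nonneg by (rule seq[rotated])
    then show False
      using LIMSEQ_le_const[of t 0 \<eta>] t \<open>0 < \<eta>\<close> by auto
  qed
  then obtain m where "0 < m" and m: "\<And>t. \<eta> \<le> t \<Longrightarrow> m \<le> w t"
    by blast
  show ?thesis
  proof (rule that[OF \<open>0 < m\<close>])
    fix u v :: 'a
    assume "norm u \<le> R" "norm v \<le> R" "\<eta> \<le> norm (u - v)"
    then have "m \<le> w (norm (u - v))" "w (norm (u - v)) \<le> inner (T u - T v) (u - v)"
      using m w by blast+
    then show "m \<le> inner (T u - T v) (u - v)"
      by (rule order_trans)
  qed
qed

subsection \<open>The damped oscillator\<close>

text \<open>The sort \<open>{real_inner, complete_space}\<close> does not entail \<open>banach\<close>, so the library arity
  of the product does not cover the phase space \<open>'a \<times> 'a\<close>.\<close>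

instance prod :: ("{real_normed_vector, complete_space}", "{real_normed_vector, complete_space}") banach ..

locale damped_oscillator =
  fixes \<phi> :: "'a::{real_inner, complete_space} \<Rightarrow> real"
    and grad A :: "'a \<Rightarrow> 'a"
    and l \<gamma> :: real
    and p :: 'a
  assumes convex: "convex_on UNIV \<phi>"
    and gderiv: "\<And>x. GDERIV \<phi> x :> grad x"
    and grad_lipschitz: "\<And>B. bounded B \<Longrightarrow> \<exists>L. L-lipschitz_on B grad"
    and cocoercive: "cocoercive l A"
    and \<gamma>_pos: "\<gamma> > 0"
    and damping: "l * \<gamma>\<^sup>2 > 1"
    and zero: "grad p + A p = 0"
begin

lemma l_pos: "l > 0"
  using cocoercive by (simp add: cocoercive_def)

text \<open>Points of phase space are pairs of position and velocity, which makes the second-order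
  equation an autonomous first-order one.\<close>

definition field :: "'a \<times> 'a \<Rightarrow> 'a \<times> 'a" where
  "field z = (snd z, - (\<gamma> *\<^sub>R snd z) - grad (fst z) - A (fst z))"

definition energy :: "'a \<times> 'a \<Rightarrow> real" where
  "energy z = (norm (snd z + (\<gamma> / 2) *\<^sub>R (fst z - p)))\<^sup>2 / 2
     + (\<phi> (fst z) - \<phi> p - inner (grad p) (fst z - p))
     + \<gamma>\<^sup>2 / 8 * (norm (fst z - p))\<^sup>2"

text \<open>The term \<open>\<gamma> / 2\<close> comes from differentiating the energy; the
  subtracted term is the price of absorbing the cross term with \<open>A\<close> through Young's
  inequality and cocoercivity.\<close>

definition decay_rate :: real where
  "decay_rate = \<gamma> / 2 - 1 / (2 * \<gamma> * l)"

lemma decay_rate_pos: "decay_rate > 0"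
proof -
  have "1 / (2 * \<gamma> * l) < l * \<gamma>\<^sup>2 / (2 * \<gamma> * l)"
    using damping \<gamma>_pos l_pos by (intro divide_strict_right_mono) auto
  also have "\<dots> = \<gamma> / 2"
    using \<gamma>_pos l_pos by (simp add: power2_eq_square)
  finally show ?thesis
    by (simp add: decay_rate_def)
qed

lemma A_p: "A p = - grad p"
  using zero by (simp add: eq_neg_iff_add_eq_0 add.commute)

lemma grad_monotone: "0 \<le> inner (grad u - grad v) (u - v)"
  using convex_on_gradient_inequality[OF convex gderiv, of u v]
    convex_on_gradient_inequality[OF convex gderiv, of v u]
  by (simp add: inner_diff_left inner_diff_right)

lemma field_lipschitz: "\<exists>L. L-lipschitz_on (cball 0 R) field"
proof -
  obtain L where L: "L-lipschitz_on (cball 0 R) grad"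
    using grad_lipschitz[OF bounded_cball] by blast
  \<comment> \<open>The four summands account for the velocity component, the friction, the gradient
    on the ball, and \<open>A\<close>, in this order.\<close>
  have "(1 + \<gamma> + L + 1 / l)-lipschitz_on (cball 0 R) field"
  proof (rule lipschitz_onI)
    fix y z :: "'a \<times> 'a"
    assume yz: "y \<in> cball 0 R" "z \<in> cball 0 R"
    have fst_le: "norm (fst y - fst z) \<le> norm (y - z)" 
      and snd_le: "norm (snd y - snd z) \<le> norm (y - z)"
      by (metis fst_diff norm_fst_le prod.collapse) (metis norm_snd_le prod.collapse snd_diff)
    have "norm (grad (fst y) - grad (fst z)) \<le> L * norm (fst y - fst z)"
      using lipschitz_onD[OF L, of "fst y" "fst z"] yz norm_fst_le[of "fst y" "snd y"] norm_fst_le[of "fst z" "snd z"]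
      by (simp add: dist_norm)
    also have "\<dots> \<le> L * norm (y - z)"
      using fst_le lipschitz_on_nonneg[OF L] by (rule mult_left_mono)
    finally have grad_le: "norm (grad (fst y) - grad (fst z)) \<le> L * norm (y - z)" .
    have "norm (A (fst y) - A (fst z)) \<le> 1 / l * norm (fst y - fst z)"
      using lipschitz_onD[OF cocoercive_imp_lipschitz_on[OF cocoercive], of "fst y" "fst z"]
      by (simp add: dist_norm)
    also have "\<dots> \<le> 1 / l * norm (y - z)"
      using fst_le l_pos by (intro mult_left_mono) auto
    finally have A_le: "norm (A (fst y) - A (fst z)) \<le> 1 / l * norm (y - z)" .
    have snd_le': "\<gamma> * norm (snd y - snd z) \<le> \<gamma> * norm (y - z)"
      using snd_le \<gamma>_pos by simp
    have "snd (field y) - snd (field z) = - (\<gamma> *\<^sub>R (snd y - snd z))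
        - (grad (fst y) - grad (fst z)) - (A (fst y) - A (fst z))"
      by (simp add: field_def algebra_simps)
    then have "norm (snd (field y) - snd (field z)) \<le> \<gamma> * norm (snd y - snd z)
        + norm (grad (fst y) - grad (fst z)) + norm (A (fst y) - A (fst z))"
      using norm_triangle_ineq4[of "- (\<gamma> *\<^sub>R (snd y - snd z)) - (grad (fst y) - grad (fst z))"
          "A (fst y) - A (fst z)"]
        norm_triangle_ineq4[of "- (\<gamma> *\<^sub>R (snd y - snd z))" "grad (fst y) - grad (fst z)"] \<gamma>_pos
      by simp
    moreover have "norm (field y - field z)
        \<le> norm (snd y - snd z) + norm (snd (field y) - snd (field z))"
      using norm_Pair_le[of "fst (field y - field z)" "snd (field y - field z)"]
      by (simp add: field_def)
    ultimately have "norm (field y - field z)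
        \<le> norm (y - z) + (\<gamma> * norm (y - z) + L * norm (y - z) + 1 / l * norm (y - z))"
      using snd_le snd_le' grad_le A_le by linarith
    then show "dist (field y) (field z) \<le> (1 + \<gamma> + L + 1 / l) * dist y z"
      by (simp add: dist_norm algebra_simps)
  next
    show "0 \<le> 1 + \<gamma> + L + 1 / l"
      using \<gamma>_pos l_pos lipschitz_on_nonneg[OF L] by simp
  qed
  then show ?thesis
    by blast
qed

section \<open>Coercivity and dissipation of the energy\<close>

lemma energy_bounds:
  shows "(norm (snd z + (\<gamma> / 2) *\<^sub>R (fst z - p)))\<^sup>2 / 2 \<le> energy z"
    and "\<gamma>\<^sup>2 / 8 * (norm (fst z - p))\<^sup>2 \<le> energy z"
    and "0 \<le> energy z"
proof -
  have "0 \<le> \<phi> (fst z) - \<phi> p - inner (grad p) (fst z - p)"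
    using convex_on_gradient_inequality[OF convex gderiv, of p "fst z"] by simp
  then show "(norm (snd z + (\<gamma> / 2) *\<^sub>R (fst z - p)))\<^sup>2 / 2 \<le> energy z"
    and "\<gamma>\<^sup>2 / 8 * (norm (fst z - p))\<^sup>2 \<le> energy z" and "0 \<le> energy z"
    by (simp_all add: energy_def add_increasing add_increasing2)
qed

text \<open>The last summand of the energy controls the position; given that, the first one controls
  the velocity.\<close>

lemma energy_sublevel_bounded: "\<exists>C. \<forall>z. energy z \<le> e \<longrightarrow> norm z \<le> C"
proof (intro exI allI impI)
  fix z
  assume e: "energy z \<le> e"
  define q where "q = fst z - p"
  have "(norm q)\<^sup>2 \<le> 8 * e / \<gamma>\<^sup>2"
    using energy_bounds(2)[of z] e \<gamma>_pos by (simp add: q_def field_simps)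
  then have q: "norm q \<le> sqrt (8 * e / \<gamma>\<^sup>2)"
    by (rule real_le_rsqrt)
  have "norm (snd z + (\<gamma> / 2) *\<^sub>R q) \<le> sqrt (2 * e)"
    using energy_bounds(1)[of z] e by (intro real_le_rsqrt) (simp add: q_def)
  moreover have "norm (snd z) \<le> norm (snd z + (\<gamma> / 2) *\<^sub>R q) + \<gamma> / 2 * norm q"
    using norm_triangle_ineq4[of "snd z + (\<gamma> / 2) *\<^sub>R q" "(\<gamma> / 2) *\<^sub>R q"] \<gamma>_pos by simp
  moreover have "\<gamma> / 2 * norm q \<le> \<gamma> / 2 * sqrt (8 * e / \<gamma>\<^sup>2)"
    using q \<gamma>_pos by (intro mult_left_mono) auto
  moreover have "norm (fst z) \<le> norm q + norm p"
    using norm_triangle_sub[of "fst z" p] by (simp add: q_def)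
  moreover have "norm z \<le> norm (fst z) + norm (snd z)"
    using norm_Pair_le[of "fst z" "snd z"] by simp
  ultimately show "norm z \<le> (sqrt (8 * e / \<gamma>\<^sup>2) + norm p) + (sqrt (2 * e) + \<gamma> / 2 * sqrt (8 * e / \<gamma>\<^sup>2))"
    using q by linarith
qed

text \<open>The weight \<open>\<gamma>\<^sup>2 / 8\<close> cancels the product of velocity and
  \<open>u - p\<close> coming from the shifted kinetic term. The Bregman term cancels
  \<open>grad u\<close> against the velocity and leaves \<open>- grad p\<close>, that is
  \<open>A p\<close>, so that \<open>A\<close> meets the velocity only through
  \<open>A u - A p\<close>.\<close>

lemma energy_has_derivative_along:
  assumes x: "(x has_vector_derivative field (x t)) (at t within S)"
  shows "((\<lambda>t. energy (x t)) has_real_derivative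
    (- (\<gamma> / 2) * (norm (snd (x t)))\<^sup>2 - inner (A (fst (x t)) - A p) (snd (x t))
      - \<gamma> / 2 * inner (grad (fst (x t)) + A (fst (x t))) (fst (x t) - p))) (at t within S)"
proof -
  define u v where "u = (\<lambda>t. fst (x t))" and "v = (\<lambda>t. snd (x t))"
  have u: "(u has_derivative (\<lambda>h. h *\<^sub>R v t)) (at t within S)"
    using bounded_linear.has_vector_derivative[OF bounded_linear_fst x]
    by (simp add: u_def v_def field_def has_vector_derivative_def)
  have v: "(v has_derivative (\<lambda>h. h *\<^sub>R (- (\<gamma> *\<^sub>R v t) - grad (u t) - A (u t)))) (at t within S)"
    using bounded_linear.has_vector_derivative[OF bounded_linear_snd x]
    by (simp add: u_def v_def field_def has_vector_derivative_def)
  have "(\<phi> has_derivative (\<lambda>h. inner h (grad (u t)))) (at (u t))"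
    using gderiv by (simp add: gderiv_def)
  with u have \<phi>: "((\<lambda>t. \<phi> (u t)) has_derivative (\<lambda>h. inner (h *\<^sub>R v t) (grad (u t)))) (at t within S)"
    by (rule has_derivative_compose)
  have r: "((\<lambda>t. u t - p) has_derivative (\<lambda>h. h *\<^sub>R v t)) (at t within S)"
    using has_derivative_diff[OF u has_derivative_const[of p]] by simp
  have q: "((\<lambda>t. v t + (\<gamma> / 2) *\<^sub>R (u t - p)) has_derivative
      (\<lambda>h. h *\<^sub>R (- (\<gamma> *\<^sub>R v t) - grad (u t) - A (u t)) + (\<gamma> / 2) *\<^sub>R (h *\<^sub>R v t))) (at t within S)"
    by (rule has_derivative_add[OF v has_derivative_scaleR_right[OF r]])
  have bregman: "((\<lambda>t. \<phi> (u t) - \<phi> p - inner (grad p) (u t - p)) has_derivative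
      (\<lambda>h. inner (h *\<^sub>R v t) (grad (u t)) - 0 - inner (grad p) (h *\<^sub>R v t))) (at t within S)"
    by (rule has_derivative_diff[OF has_derivative_diff[OF \<phi> has_derivative_const]
          has_derivative_inner_right[OF r]])
  have "((\<lambda>t. 1 / 2 * inner (v t + (\<gamma> / 2) *\<^sub>R (u t - p)) (v t + (\<gamma> / 2) *\<^sub>R (u t - p))
      + (\<phi> (u t) - \<phi> p - inner (grad p) (u t - p)) + \<gamma>\<^sup>2 / 8 * inner (u t - p) (u t - p))
    has_derivative (\<lambda>h. (- (\<gamma> / 2) * inner (v t) (v t) - inner (A (u t) - A p) (v t)
      - \<gamma> / 2 * inner (grad (u t) + A (u t)) (u t - p)) * h)) (at t within S)"
    by (rule has_derivative_eq_rhs[OF has_derivative_add[OF has_derivative_add[OF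
            has_derivative_mult_right[OF has_derivative_inner[OF q q]] bregman]
            has_derivative_mult_right[OF has_derivative_inner[OF r r]]]])
      (simp add: A_p fun_eq_iff algebra_simps inner_commute power2_eq_square)
  then show ?thesis
    by (simp add: has_field_derivative_def energy_def u_def v_def power2_norm_eq_inner)
qed

text \<open>Since \<open>p\<close> is a zero, the right side splits into a gradient part,
  nonnegative by monotonicity, and an \<open>A\<close> part, to which cocoercivity applies.\<close>

lemma operator_bound: "l * (norm (A u - A p))\<^sup>2 \<le> inner (grad u + A u) (u - p)"
proof -
  have "l * (norm (A u - A p))\<^sup>2 \<le> inner (A u - A p) (u - p)"
    using cocoercive by (simp add: cocoercive_def)
  moreover have "inner (grad u + A u) (u - p) = inner (grad u - grad p) (u - p) + inner (A u - A p) (u - p)"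
    by (simp add: A_p flip: inner_add_left)
  ultimately show ?thesis
    using grad_monotone[of u p] by linarith
qed

lemma operator_nonneg: "0 \<le> inner (grad u + A u) (u - p)"
  by (rule order_trans[OF _ operator_bound]) (use l_pos in simp)

text \<open>Cocoercivity absorbs the cross term \<open>inner (A u - A p) v\<close>, which Young's inequality splits
  with weight \<open>\<gamma>\<close>; what is left over has a sign because \<open>l * \<gamma>\<^sup>2 > 1\<close>.\<close>

lemma energy_dissipation:
  "- (\<gamma> / 2) * (norm v)\<^sup>2 - inner (A u - A p) v - \<gamma> / 2 * inner (grad u + A u) (u - p)
    \<le> - decay_rate * inner (grad u + A u) (u - p)"
proof -
  define a where "a = A u - A p"
  have "l * (norm a)\<^sup>2 \<le> inner (grad u + A u) (u - p)"
    unfolding a_def by (rule operator_bound)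
  then have "1 / (2 * \<gamma>) * (norm a)\<^sup>2 \<le> 1 / (2 * \<gamma> * l) * inner (grad u + A u) (u - p)"
    using l_pos \<gamma>_pos by (simp add: field_simps)
  moreover have "- inner a v \<le> 1 / (2 * \<gamma>) * (norm a)\<^sup>2 + \<gamma> / 2 * (norm v)\<^sup>2"
  proof -
    \<comment> \<open>Expanding this square and dividing by \<open>2 * \<gamma>\<close> gives
      Young's inequality with exactly the friction coefficient in front of the velocity.\<close>
    have "0 \<le> (norm (a + \<gamma> *\<^sub>R v))\<^sup>2"
      by simp
    also have "\<dots> = (norm a)\<^sup>2 + 2 * \<gamma> * inner a v + \<gamma>\<^sup>2 * (norm v)\<^sup>2"
      unfolding power2_norm_eq_inner by (simp add: algebra_simps inner_commute power2_eq_square)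
    finally show ?thesis
      using \<gamma>_pos by (simp add: field_simps power2_eq_square)
  qed
  moreover have "- decay_rate * inner (grad u + A u) (u - p)
      = 1 / (2 * \<gamma> * l) * inner (grad u + A u) (u - p) - \<gamma> / 2 * inner (grad u + A u) (u - p)"
    unfolding decay_rate_def minus_diff_eq by (rule left_diff_distrib)
  ultimately show ?thesis
    unfolding a_def by linarith
qed

text \<open>Used with \<open>m = 0\<close> for monotonicity of the energy, and with
  \<open>m > 0\<close> for a definite loss while the position stays away from
  \<open>p\<close>.\<close>

lemma energy_decrease:
  assumes "a \<le> b"
    and x: "\<And>t. t \<in> {a..b} \<Longrightarrow> (x has_vector_derivative field (x t)) (at t within {a..b})"
    and m: "\<And>t. t \<in> {a..b} \<Longrightarrow> m \<le> inner (grad (fst (x t)) + A (fst (x t))) (fst (x t) - p)"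
  shows "energy (x b) \<le> energy (x a) - decay_rate * m * (b - a)"
proof -
  have "energy (x b) - energy (x a) \<le> (- decay_rate * m) * (b - a)"
  proof (rule real_derivative_le_imp_diff_le[OF \<open>a \<le> b\<close> energy_has_derivative_along])
    fix t
    assume t: "t \<in> {a..b}"
    show "(x has_vector_derivative field (x t)) (at t within {a..b})"
      using t by (rule x)
    have "- decay_rate * inner (grad (fst (x t)) + A (fst (x t))) (fst (x t) - p) \<le> - decay_rate * m"
      using m[OF t] decay_rate_pos by simp
    then show "- (\<gamma> / 2) * (norm (snd (x t)))\<^sup>2 - inner (A (fst (x t)) - A p) (snd (x t))
      - \<gamma> / 2 * inner (grad (fst (x t)) + A (fst (x t))) (fst (x t) - p) \<le> - decay_rate * m"
      using energy_dissipation by (rule order_trans[rotated])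
  qed
  then show ?thesis
    by simp
qed

lemma energy_antimono:
  assumes "a \<le> b"
    and "\<And>t. t \<in> {a..b} \<Longrightarrow> (x has_vector_derivative field (x t)) (at t within {a..b})"
  shows "energy (x b) \<le> energy (x a)"
proof -
  have "energy (x b) \<le> energy (x a) - decay_rate * 0 * (b - a)"
    by (rule energy_decrease[OF assms operator_nonneg])
  then show ?thesis
    by simp
qed

section \<open>Global flow and its convergence\<close>

lemma flow_exists:
  "\<exists>x. x 0 = x0 \<and> (\<forall>t\<ge>0. (x has_vector_derivative field (x t)) (at t within {0..}))"
proof -
  obtain C where "\<And>z. energy z \<le> energy x0 \<Longrightarrow> norm z \<le> C"
    using energy_sublevel_bounded by blast
  then have "norm (x T) \<le> C"
    if "0 \<le> T" "x 0 = x0"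
      "\<And>t. t \<in> {0..T} \<Longrightarrow> (x has_vector_derivative field (x t)) (at t within {0..T})" for T x
    using energy_antimono[of 0 T x] that by simp
  then show ?thesis
    by (rule ivp_exists_of_apriori_bound[OF field_lipschitz])
qed

lemma flow_tendsto:
  assumes mono: "strongly_monotone_on_bounded (\<lambda>v. grad v + A v)"
    and x: "\<And>t. 0 \<le> t \<Longrightarrow> (x has_vector_derivative field (x t)) (at t within {0..})"
  shows "((\<lambda>t. fst (x t)) \<longlongrightarrow> p) at_top"
proof (rule tendstoI)
  fix \<eta> :: real
  assume "0 < \<eta>"
  define u where "u = (\<lambda>t. fst (x t))"
  have x_sub: "(x has_vector_derivative field (x t)) (at t within {a..b})"
    if "0 \<le> a" "t \<in> {a..b}" for a b t
    using that by (intro has_vector_derivative_within_subset[OF x]) auto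
  have decreasing: "energy (x b) \<le> energy (x a)" if "0 \<le> a" "a \<le> b" for a b
    using that x_sub by (intro energy_antimono)
  obtain C where C: "\<And>z. energy z \<le> energy (x 0) \<Longrightarrow> norm z \<le> C"
    using energy_sublevel_bounded by blast
  \<comment> \<open>One constant serves as radius for strong monotonicity, containing the orbit and
    \<open>p\<close>, and as Lipschitz constant of \<open>u\<close>, bounding the velocity. The 1
    makes it safe to divide by.\<close>
  define K where "K = max 1 (max C (norm p))"
  have K: "1 \<le> K" "norm p \<le> K"
    by (auto simp: K_def)
  have xK: "norm (x t) \<le> K" if "0 \<le> t" for t
    using C[OF decreasing[of 0 t]] that by (simp add: K_def)
  then have uK: "norm (u t) \<le> K" and vK: "norm (snd (x t)) \<le> K" if "0 \<le> t" for t
    using that norm_fst_le[of "fst (x t)" "snd (x t)"] norm_snd_le[of "snd (x t)" "fst (x t)"] by (force simp: u_def)+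
  have u_lipschitz: "norm (u s - u t) \<le> K * \<bar>s - t\<bar>" if "0 \<le> s" "0 \<le> t" for s t
  proof -
    have "norm (u s - u t) \<le> K * norm (s - t)"
    proof (rule differentiable_bound[of "{0..}" u "\<lambda>t h. h *\<^sub>R snd (x t)"])
      fix t :: real
      assume t: "t \<in> {0..}"
      then show "(u has_derivative (\<lambda>h. h *\<^sub>R snd (x t))) (at t within {0..})"
        using bounded_linear.has_vector_derivative[OF bounded_linear_fst x[of t]]
        by (simp add: u_def field_def has_vector_derivative_def)
      show "onorm (\<lambda>h. h *\<^sub>R snd (x t)) \<le> K"
        using vK[of t] t by (intro onorm_le) (auto simp: mult.commute[of K] intro: mult_left_mono)
    qed (use that in auto)
    then show ?thesis
      by simp
  qed
  obtain m where m: "0 < m" "\<And>v w. norm v \<le> K \<Longrightarrow> norm w \<le> K \<Longrightarrow> \<eta> / 2 \<le> norm (v - w) \<Longrightarrow>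
      m \<le> inner ((grad v + A v) - (grad w + A w)) (v - w)"
    using strongly_monotone_on_bounded_lower_bound[OF mono, of K "\<eta> / 2"] K \<open>0 < \<eta>\<close> by auto
  \<comment> \<open>During time \<tau> the position moves by at most \<open>\<eta> / 2\<close>, so a
    point at distance \<eta> from \<open>p\<close> stays at distance \<open>\<eta> / 2\<close>
    throughout.\<close>
  define \<tau> where "\<tau> = \<eta> / (2 * K)"
  have \<tau>: "0 < \<tau>" "K * \<tau> = \<eta> / 2"
    using \<open>0 < \<eta>\<close> K by (auto simp: \<tau>_def)
  have drop: "energy (x (t + \<tau>)) \<le> energy (x t) - decay_rate * m * \<tau>"
    if t: "0 \<le> t" and far: "\<eta> \<le> norm (u t - p)" for t
  proof -
    have "m \<le> inner (grad (u s) + A (u s)) (u s - p)" if s: "s \<in> {t..t + \<tau>}" for s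
    proof -
      have "norm (u t - u s) \<le> K * \<bar>t - s\<bar>"
        using s t by (intro u_lipschitz) auto
      also have "\<dots> \<le> K * \<tau>"
        using s K by (intro mult_left_mono) auto
      finally have "\<eta> / 2 \<le> norm (u s - p)"
        using far \<tau> norm_triangle_ineq[of "u t - u s" "u s - p"] by simp
      then show ?thesis
        using m(2)[of "u s" p] K uK[of s] s t zero by simp
    qed
    then show ?thesis
      using energy_decrease[of t "t + \<tau>" x m] x_sub t \<tau> by (simp add: u_def)
  qed
  \<comment> \<open>Once the energy is within one such loss of its infimum, it stays so by
    monotonicity, and any later excursion to distance \<eta> would push it below the
    infimum.\<close>
  define I where "I = (INF t\<in>{0..}. energy (x t))"
  have bdd: "bdd_below ((\<lambda>t. energy (x t)) ` {0..})"
    using energy_bounds(3) by (intro bdd_belowI2[of _ 0]) auto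
  have "0 < decay_rate * m * \<tau>"
    using decay_rate_pos m \<tau> by simp
  then have "\<exists>t\<in>{0..}. energy (x t) < I + decay_rate * m * \<tau>"
    using cINF_less_iff[OF _ bdd, of "I + decay_rate * m * \<tau>"] by (auto simp: I_def)
  then obtain T where T: "0 \<le> T" "energy (x T) < I + decay_rate * m * \<tau>"
    by auto
  have "dist (fst (x t)) p < \<eta>" if "T \<le> t" for t
  proof (rule ccontr)
    assume "\<not> dist (fst (x t)) p < \<eta>"
    then have "energy (x (t + \<tau>)) \<le> energy (x t) - decay_rate * m * \<tau>"
      using that T by (intro drop) (auto simp: u_def dist_norm)
    moreover have "I \<le> energy (x (t + \<tau>))"
      unfolding I_def using that T \<tau> by (intro cINF_lower bdd) auto
    ultimately show False
      using decreasing[of T t] T that by linarith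
  qed
  then show "eventually (\<lambda>t. dist (fst (x t)) p < \<eta>) at_top"
    by (auto simp: eventually_at_top_linorder)
qed

section \<open>Phase-space flow and the second-order equation\<close>

lemma field_continuous_on: "continuous_on UNIV field"
proof -
  have "isCont field z" for z
  proof -
    \<comment> \<open>The enlarged radius puts \<open>z\<close> in the interior of the ball.\<close>
    obtain L where "L-lipschitz_on (cball 0 (norm z + 1)) field"
      using field_lipschitz by blast
    then have "continuous_on (ball 0 (norm z + 1)) field"
      by (intro continuous_on_subset[OF lipschitz_on_continuous_on]) auto
    then show ?thesis
      by (rule continuous_on_interior) auto
  qed
  then show ?thesis
    by (simp add: continuous_on_eq_continuous_at)
qed

lemma C2_solution_of_flow:
  assumes x: "\<And>t. 0 \<le> t \<Longrightarrow> (x has_vector_derivative field (x t)) (at t within {0..})"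
  shows "C2_solution \<gamma> grad A (fst (x 0)) (snd (x 0)) (\<lambda>t. fst (x t))"
  unfolding C2_solution_def
proof (intro exI conjI allI impI)
  show "((\<lambda>t. fst (x t)) has_vector_derivative snd (x t)) (at t within {0..})" if "0 \<le> t" for t
    using bounded_linear.has_vector_derivative[OF bounded_linear_fst x[OF that]]
    by (simp add: field_def)
  show "((\<lambda>t. snd (x t)) has_vector_derivative snd (field (x t))) (at t within {0..})" if "0 \<le> t" for t
    using bounded_linear.has_vector_derivative[OF bounded_linear_snd x[OF that]] .
  \<comment> \<open>The acceleration is the second component of the field along the orbit, hence
    continuous.\<close>
  have "continuous_on {0..} x"
    using x unfolding continuous_on_eq_continuous_within
    by (blast intro: has_vector_derivative_continuous)
  then show "continuous_on {0..} (\<lambda>t. snd (field (x t)))"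
    by (intro continuous_on_snd continuous_on_compose2[OF field_continuous_on]) auto
qed (simp_all add: field_def)

text \<open>This converse translation makes uniqueness for the first-order system available for the
  second-order problem.\<close>

lemma flow_of_C2_solution:
  assumes "C2_solution \<gamma> grad A u0 v0 w"
  shows "\<exists>w'. w 0 = u0 \<and> w' 0 = v0 \<and>
    (\<forall>t\<ge>0. ((\<lambda>t. (w t, w' t)) has_vector_derivative field (w t, w' t)) (at t within {0..}))"
proof -
  obtain w' w'' where w: "\<And>t. 0 \<le> t \<Longrightarrow> (w has_vector_derivative w' t) (at t within {0..})"
    and w': "\<And>t. 0 \<le> t \<Longrightarrow> (w' has_vector_derivative w'' t) (at t within {0..})"
    and eq: "\<And>t. 0 \<le> t \<Longrightarrow> w'' t + \<gamma> *\<^sub>R w' t + grad (w t) + A (w t) = 0"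
    and init: "w 0 = u0" "w' 0 = v0"
    using assms unfolding C2_solution_def by blast
  have "field (w t, w' t) = (w' t, w'' t)" if "0 \<le> t" for t
  proof -
    have "w'' t - (- (\<gamma> *\<^sub>R w' t) - grad (w t) - A (w t)) = 0"
      using eq[OF that] by (simp add: algebra_simps)
    then show ?thesis
      by (simp add: field_def)
  qed
  then show ?thesis
    using w w' init by (auto intro!: has_vector_derivative_Pair exI[of _ w'])
qed

lemma C2_solution_unique:
  assumes "C2_solution \<gamma> grad A u0 v0 u" "C2_solution \<gamma> grad A u0 v0 w" "0 \<le> t"
  shows "w t = u t"
proof -
  obtain u' where u: "u 0 = u0" "u' 0 = v0"
    "\<And>t. 0 \<le> t \<Longrightarrow> ((\<lambda>t. (u t, u' t)) has_vector_derivative field (u t, u' t)) (at t within {0..})"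
    using flow_of_C2_solution[OF assms(1)] by blast
  obtain w' where w: "w 0 = u0" "w' 0 = v0"
    "\<And>t. 0 \<le> t \<Longrightarrow> ((\<lambda>t. (w t, w' t)) has_vector_derivative field (w t, w' t)) (at t within {0..})"
    using flow_of_C2_solution[OF assms(2)] by blast
  have "(w t, w' t) = (u t, u' t)"
    using u w by (intro ivp_unique[OF field_lipschitz w(3) u(3) _ \<open>0 \<le> t\<close>]) simp_all
  then show ?thesis
    by simp
qed

lemma convergent_C2_solution_exists:
  assumes mono: "strongly_monotone_on_bounded (\<lambda>v. grad v + A v)"
  shows "\<exists>u. C2_solution \<gamma> grad A u0 v0 u \<and>
    (u \<longlongrightarrow> p) at_top"
proof -
  obtain x where "x 0 = (u0, v0)"
    and x: "\<And>t. 0 \<le> t \<Longrightarrow> (x has_vector_derivative field (x t)) (at t within {0..})"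
    using flow_exists by blast
  then show ?thesis
    using C2_solution_of_flow[OF x] flow_tendsto[OF mono x] by auto
qed

end

section \<open>Uniqueness of the zero and conclusion\<close>

lemma strongly_monotone_zero_unique:
  assumes mono: "strongly_monotone_on_bounded T" and "T p = 0" "T q = 0"
  shows "q = p"
proof (rule ccontr)
  assume "q \<noteq> p"
  \<comment> \<open>On a ball containing both zeros, a positive distance would force a positive
    inner product, but \<open>T q - T p\<close> vanishes.\<close>
  define R where "R = 1 + norm p + norm q"
  have R: "0 < R" "norm p \<le> R" "norm q \<le> R"
    by (auto simp: R_def add_pos_nonneg)
  obtain m where "0 < m" "m \<le> inner (T q - T p) (q - p)"
    using strongly_monotone_on_bounded_lower_bound[OF mono R(1), of "norm (q - p)"] R \<open>q \<noteq> p\<close>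
    by (metis order_refl right_minus_eq zero_less_norm_iff)
  then show False
    using assms by simp
qed

theorem proposition2p1:
  fixes \<phi> :: "'a::{real_inner, complete_space} \<Rightarrow> real"
    and grad\<phi> A :: "'a \<Rightarrow> 'a"
    and l \<gamma> :: real
  assumes "convex_on UNIV \<phi>"
    and "\<And>x. GDERIV \<phi> x :> grad\<phi> x"
    and "\<And>B. bounded B \<Longrightarrow> \<exists>L. L-lipschitz_on B grad\<phi>"
    and "maximal_monotone A"
    and "l > 0"
    and "cocoercive l A"
    and "\<gamma> > 0"
    and "l * \<gamma>\<^sup>2 > 1"
    and "{v. grad\<phi> v + A v = 0} \<noteq> {}"
    and "strongly_monotone_on_bounded (\<lambda>v. grad\<phi> v + A v)"
  shows "\<exists>p. {v. grad\<phi> v + A v = 0} = {p} \<and>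
    (\<forall>u0 v0. \<exists>u. C2_solution \<gamma> grad\<phi> A u0 v0 u \<and>
       (\<forall>w. C2_solution \<gamma> grad\<phi> A u0 v0 w \<longrightarrow> (\<forall>t\<ge>0. w t = u t)) \<and>
       (u \<longlongrightarrow> p) at_top)"
proof -
  obtain p where p: "grad\<phi> p + A p = 0"
    using assms(9) by blast
  have "damped_oscillator \<phi> grad\<phi> A l \<gamma> p"
    by (rule damped_oscillator.intro[OF assms(1,2,3,6,7,8) p])
  then interpret damped_oscillator \<phi> grad\<phi> A l \<gamma> p .
  have "{v. grad\<phi> v + A v = 0} = {p}"
    using p strongly_monotone_zero_unique[OF assms(10) p] by blast
  moreover have "\<exists>u. C2_solution \<gamma> grad\<phi> A u0 v0 u \<and>
       (\<forall>w. C2_solution \<gamma> grad\<phi> A u0 v0 w \<longrightarrow> (\<forall>t\<ge>0. w t = u t)) \<and>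
       (u \<longlongrightarrow> p) at_top" for u0 v0
  proof -
    obtain u where u: "C2_solution \<gamma> grad\<phi> A u0 v0 u" "(u \<longlongrightarrow> p) at_top"
      using convergent_C2_solution_exists[OF assms(10)] by blast
    then show ?thesis
      using C2_solution_unique[OF u(1)] by blast
  qed
  ultimately show ?thesis
    by blast
qed

end
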